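(* Let $\mathcal{A}$ be a commutative associative algebra over a field $\mathbb{F}$, let $\alpha\in\mathbb{F}$, and let $R:\mathcal{A}\to\mathcal{A}$ be a linear map such that $R(R(x))=\alpha x$ and $R(x)\cdot y+x\cdot R(y)=R(x\cdot y)$ for all $x,y\in\mathcal{A}$. Then the product $x\circ y=R(x)\cdot y$ defines a (left) Pre-Lie algebra structure on $\mathcal{A}$.
   Context: Algebras are not assumed to be unital. A left Pre-Lie algebra is an algebra $A$ over a field $\mathbb{F}$ with a bilinear product $\circ$ satisfying $(x\circ y)\circ z-x\circ(y\circ z)=(y\circ x)\circ z-y\circ(x\circ z)$ for all $x,y,z\in A$. *)

theory Defs
  imports Complex_Main
begin

text \<open>
  Algebras are neither assumed unital, nor associative, nor commutative: an algebra is a vector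
  space with a bilinear product. The carrier is the whole type, and the additive structure is
  the one of its type class; the scalar multiplication and the product are explicit parameters.
\<close>

locale alg = vector_space scale
  for scale :: "'f::field \<Rightarrow> 'a::ab_group_add \<Rightarrow> 'a" +
  fixes mult :: "'a \<Rightarrow> 'a \<Rightarrow> 'a"
  assumes linear_left: "Vector_Spaces.linear scale scale (\<lambda>x. mult x y)"
    and linear_right: "Vector_Spaces.linear scale scale (\<lambda>y. mult x y)"

locale comm_assoc_alg = alg scale mult
  for scale :: "'f::field \<Rightarrow> 'a::ab_group_add \<Rightarrow> 'a" and mult :: "'a \<Rightarrow> 'a \<Rightarrow> 'a" +
  assumes assoc: "mult (mult x y) z = mult x (mult y z)"
    and commute: "mult x y = mult y x"

locale left_pre_lie_alg = alg scale mult
  for scale :: "'f::field \<Rightarrow> 'a::ab_group_add \<Rightarrow> 'a" and mult :: "'a \<Rightarrow> 'a \<Rightarrow> 'a" +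
  assumes left_symmetric:
    "mult (mult x y) z - mult x (mult y z) = mult (mult y x) z - mult y (mult x z)"

end

theory Submission
  imports Defs
begin

text \<open>
  The map \<open>R\<close> is a derivation with \<open>R\<^sup>2 = \<alpha>\<close>, so
  \<open>R (R x \<cdot> y) = \<alpha> (x \<cdot> y) + R x \<cdot> R y\<close>. Multiplying by \<open>z\<close> gives
  \<open>(x \<circ> y) \<circ> z\<close>, and its second summand is \<open>x \<circ> (y \<circ> z)\<close> by associativity. The associator
  of \<open>\<circ>\<close> is therefore \<open>\<alpha> ((x \<cdot> y) \<cdot> z)\<close>, which is symmetric in \<open>x\<close> and \<open>y\<close> by commutativity.
\<close>

theorem proposition5p0p1:
  fixes scale :: "'f::field \<Rightarrow> 'a::ab_group_add \<Rightarrow> 'a"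
    and mult :: "'a \<Rightarrow> 'a \<Rightarrow> 'a"
    and R :: "'a \<Rightarrow> 'a"
    and \<alpha> :: 'f
  assumes "comm_assoc_alg scale mult"
    and "Vector_Spaces.linear scale scale R"
    and "\<And>x. R (R x) = scale \<alpha> x"
    and "\<And>x y. mult (R x) y + mult x (R y) = R (mult x y)"
  shows "left_pre_lie_alg scale (\<lambda>x y. mult (R x) y)"
proof -
  interpret comm_assoc_alg scale mult by fact
  interpret left: Vector_Spaces.linear scale scale "\<lambda>x. mult x y" for y
    by (rule linear_left)
  have associator: "mult (R (mult (R x) y)) z - mult (R x) (mult (R y) z)
      = scale \<alpha> (mult (mult x y) z)" for x y z
  proof -
    have "R (mult (R x) y) = mult (scale \<alpha> x) y + mult (R x) (R y)"
      using assms(4)[of "R x" y] by (simp add: assms(3))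
    also have "mult (scale \<alpha> x) y = scale \<alpha> (mult x y)"
      by (rule left.scale)
    finally have "mult (R (mult (R x) y)) z
        = mult (scale \<alpha> (mult x y)) z + mult (mult (R x) (R y)) z"
      by (simp add: left.add)
    then show ?thesis
      by (simp add: left.scale assoc)
  qed
  show ?thesis
  proof (intro left_pre_lie_alg.intro alg.intro alg_axioms.intro left_pre_lie_alg_axioms.intro vector_space_axioms)
    fix x y z
    show "Vector_Spaces.linear scale scale (\<lambda>x. mult (R x) y)"
      using Vector_Spaces.linear_compose[OF assms(2) linear_left[of y]] by (simp add: o_def)
    show "Vector_Spaces.linear scale scale (\<lambda>y. mult (R x) y)"
      by (rule linear_right)
    show "mult (R (mult (R x) y)) z - mult (R x) (mult (R y) z)
        = mult (R (mult (R y) x)) z - mult (R y) (mult (R x) z)"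
      by (simp only: associator commute[of x y])
  qed
qed

end
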